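(* Let $n\ge 2$ and let $\mathbf{v}_1+\mathcal{L}_1,\dots,\mathbf{v}_n+\mathcal{L}_n$ be a lattice tiling of $\mathbb{Z}^2$. Let $e_i$ be the multiplicity of $\mathcal{L}_i$, and suppose the sublattices are indexed so that for all $i<j$: (a) $\frac{1}{e_i}\det\mathcal{L}_i\ge\frac{1}{e_j}\det\mathcal{L}_j$; and (b) if $\frac{1}{e_i}\det\mathcal{L}_i=\frac{1}{e_j}\det\mathcal{L}_j$, then $e_i\ge e_j$. If $e_1=p^r$ for some prime $p$ and some integer $r\ge 0$, then the tiling has the translational property.
   Context: A sublattice is a full-rank (equivalently finite-index) subgroup of $\mathbb{Z}^2$. Its determinant $\det\mathcal{L}$ is its index in $\mathbb{Z}^2$. If $\mathcal{L}\subseteq\mathbb{Z}^2$ is generated by $(a,b)$ and $(c,d)$, its multiplicity is $e=\gcd(a,b,c,d)$, which does not depend on the choice of basis. A lattice tiling of $\mathbb{Z}^2$ is a finite collection of sublattices $\mathcal{L}_1,\dots,\mathcal{L}_n$ and vectors $\mathbf{v}_1,\dots,\mathbf{v}_n\in\mathbb{Z}^2$ such that the sets $\mathbf{v}_i+\mathcal{L}_i=\{\mathbf{v}_i+\mathbf{w}:\mathbf{w}\in\mathcal{L}_i\}$ are pairwise disjoint (for distinct indices) and their union is $\mathbb{Z}^2$. A lattice tiling has the translational property if at least two of its translated sublattices are different cosets of the same sublattice, i.e. there exist $i\neq j$ with $\mathcal{L}_i=\mathcal{L}_j$. *)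

theory Defs
  imports Complex_Main "HOL-Algebra.Elementary_Groups" "HOL-Computational_Algebra.Primes"
    "HOL-Library.Disjoint_Sets"
begin

abbreviation Z2 :: "(int \<times> int) monoid" where
  "Z2 \<equiv> integer_group \<times>\<times> integer_group"

definition sublattice :: "(int \<times> int) set \<Rightarrow> bool" where
  "sublattice L \<longleftrightarrow> subgroup L Z2 \<and> finite (rcosets\<^bsub>Z2\<^esub> L)"

definition lattice_det :: "(int \<times> int) set \<Rightarrow> nat" where
  "lattice_det L = card (rcosets\<^bsub>Z2\<^esub> L)"

text \<open>
  The description below determines a number only when \<open>L\<close> is generated by two vectors, as every
  sublattice is; its independence of the chosen generators is \<open>lattice_multiplicity_eq\<close>.
\<close>

definition lattice_multiplicity :: "(int \<times> int) set \<Rightarrow> nat" where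
  "lattice_multiplicity L =
     (THE e. \<exists>a b c d. L = generate Z2 {(a, b), (c, d)} \<and> int e = Gcd {a, b, c, d})"

definition lattice_tiling ::
  "nat \<Rightarrow> (nat \<Rightarrow> (int \<times> int) set) \<Rightarrow> (nat \<Rightarrow> int \<times> int) \<Rightarrow> bool" where
  "lattice_tiling n L v \<longleftrightarrow>
     (\<forall>i\<in>{1..n}. sublattice (L i)) \<and>
     disjoint_family_on (\<lambda>i. v i <#\<^bsub>Z2\<^esub> L i) {1..n} \<and>
     (\<Union>i\<in>{1..n}. v i <#\<^bsub>Z2\<^esub> L i) = UNIV"

definition translational_property :: "nat \<Rightarrow> (nat \<Rightarrow> (int \<times> int) set) \<Rightarrow> bool" where
  "translational_property n L \<longleftrightarrow> (\<exists>i\<in>{1..n}. \<exists>j\<in>{1..n}. i \<noteq> j \<and> L i = L j)"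

lemma dvd_of_generate:
  fixes k a b c d :: int
  assumes "x \<in> generate Z2 {(a, b), (c, d)}" and "\<forall>y\<in>{a, b, c, d}. k dvd y"
  shows "k dvd fst x \<and> k dvd snd x"
  using assms(1)
proof (induction rule: generate.induct)
  case one
  show ?case by simp
next
  case (incl h)
  then show ?case using assms(2) by auto
next
  case (inv h)
  have "inv\<^bsub>Z2\<^esub> h = (- fst h, - snd h)"
    using inv_DirProd[of integer_group integer_group "fst h" "snd h"] by simp
  moreover have "k dvd fst h \<and> k dvd snd h"
    using inv assms(2) by auto
  ultimately show ?case by simp
next
  case (eng x y)
  have "x \<otimes>\<^bsub>Z2\<^esub> y = (fst x + fst y, snd x + snd y)"
    by (simp add: DirProd_def case_prod_unfold)
  with eng show ?case by simp
qed

lemma Gcd_dvd_of_generate_subset: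
  fixes a b c d a' b' c' d' :: int
  assumes "generate Z2 {(a', b'), (c', d')} \<subseteq> generate Z2 {(a, b), (c, d)}"
  shows "Gcd {a, b, c, d} dvd Gcd {a', b', c', d'}"
proof -
  define k where "k = Gcd {a, b, c, d}"
  have k: "\<forall>y\<in>{a, b, c, d}. k dvd y"
    unfolding k_def by (blast intro: Gcd_dvd)
  have "(a', b') \<in> generate Z2 {(a, b), (c, d)}"
    by (rule subsetD[OF assms], rule generate.incl, rule insertI1)
  moreover have "(c', d') \<in> generate Z2 {(a, b), (c, d)}"
    by (rule subsetD[OF assms], rule generate.incl, rule insertI2, rule insertI1)
  ultimately have "k dvd a' \<and> k dvd b'" "k dvd c' \<and> k dvd d'"
    using dvd_of_generate[OF _ k] by fastforce+
  then have "k dvd Gcd {a', b', c', d'}"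
    by (intro Gcd_greatest) blast
  then show ?thesis unfolding k_def .
qed

lemma lattice_multiplicity_eq:
  assumes L: "L = generate Z2 {(a, b), (c, d)}"
  shows "int (lattice_multiplicity L) = Gcd {a, b, c, d}"
proof -
  have nonneg: "0 \<le> Gcd A" for A :: "int set"
    by (rule Gcd_int_greater_eq_0)
  have unique: "Gcd {a', b', c', d'} = Gcd {a, b, c, d}"
    if L': "L = generate Z2 {(a', b'), (c', d')}" for a' b' c' d'
  proof (rule zdvd_antisym_nonneg[OF nonneg nonneg])
    show "Gcd {a', b', c', d'} dvd Gcd {a, b, c, d}"
      by (rule Gcd_dvd_of_generate_subset) (unfold L[symmetric] L'[symmetric], rule order_refl)
    show "Gcd {a, b, c, d} dvd Gcd {a', b', c', d'}"
      by (rule Gcd_dvd_of_generate_subset) (unfold L[symmetric] L'[symmetric], rule order_refl)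
  qed
  have "lattice_multiplicity L = nat (Gcd {a, b, c, d})"
    unfolding lattice_multiplicity_def
  proof (rule the_equality)
    show "\<exists>a' b' c' d'. L = generate Z2 {(a', b'), (c', d')} \<and>
            int (nat (Gcd {a, b, c, d})) = Gcd {a', b', c', d'}"
      by (intro exI conjI) (rule L, rule nat_0_le, rule nonneg)
  next
    fix e
    assume "\<exists>a' b' c' d'. L = generate Z2 {(a', b'), (c', d')} \<and> int e = Gcd {a', b', c', d'}"
    then obtain a' b' c' d' where "L = generate Z2 {(a', b'), (c', d')}"
      and e: "int e = Gcd {a', b', c', d'}"
      by blast
    show "e = nat (Gcd {a, b, c, d})"
      unfolding unique[OF \<open>L = generate Z2 {(a', b'), (c', d')}\<close>, symmetric] e[symmetric]
      by (rule nat_int[symmetric])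
  qed
  then show ?thesis by (simp only: nat_0_le nonneg)
qed

end

theory Submission
  imports Defs "HOL-Library.Product_Plus"
begin

text \<open>
  Write \<open>N\<^sub>i = det L\<^sub>i / e\<^sub>i\<close>; since \<open>\<int>\<^sup>2 / L\<^sub>i\<close> is isomorphic to \<open>\<int>/e\<^sub>i \<times> \<int>/N\<^sub>i\<close>, this is
  the exponent of the quotient, an integer, and \<open>N = N\<^sub>1\<close> is the largest of them. There is a linear
  functional \<open>\<phi>\<close> that maps \<open>\<int>\<^sup>2\<close> onto \<open>\<int>/N\<close> and kills \<open>L\<^sub>1\<close> (\<open>exists_primitive_functional\<close>). If
  \<open>\<phi>\<close> kills another \<open>L\<^sub>i\<close> as well, then maximality of \<open>N\<close> forces \<open>N\<^sub>i = N\<close> and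
  \<open>L\<^sub>i = e\<^sub>i \<int>\<^sup>2 \<inter> ker \<phi>\<close> (\<open>hermite_eq_of_le_kernel\<close>): such a sublattice is determined by \<open>e\<^sub>i\<close>.
  Hence, unless \<open>L\<^sub>i = L\<^sub>1\<close>, condition (b) gives \<open>e\<^sub>i < e\<^sub>1 = p\<^sup>r\<close>.

  The other sublattices have a nontrivial image under \<open>\<phi>\<close>, and can be filtered out of the tiling
  with an integer weight \<open>g\<close> on \<open>\<int>/N\<close> that has \<open>g 0 = 1\<close> but sums to zero over each coset of each
  nontrivial subgroup (\<open>exists_balanced_weight\<close>). Sum \<open>g (\<phi> w - \<phi> v\<^sub>1)\<close> over all \<open>w\<close> in a large box,
  on which everything is periodic, and split this sum along the tiling. The total is \<open>0\<close>; a
  translate with \<open>\<phi>(L\<^sub>i) \<noteq> 0\<close> contributes \<open>0\<close> (\<open>box_sum_weight_eq_0\<close>); on every other translate the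
  weight is a constant \<open>g\<^sub>i\<close>, and its contribution is proportional to \<open>g\<^sub>i / det L\<^sub>i = g\<^sub>i / (e\<^sub>i N)\<close>
  (\<open>box_sum_coset\<close>). With \<open>g\<^sub>1 = 1\<close> this says
    \<open>1 / p\<^sup>r = - \<Sum> g\<^sub>i / e\<^sub>i\<close>,
  where \<open>i \<noteq> 1\<close> ranges over indices with \<open>\<phi>(L\<^sub>i) = 0\<close>. If no such \<open>L\<^sub>i\<close> equals \<open>L\<^sub>1\<close>, then no \<open>e\<^sub>i\<close> on
  the right is divisible by \<open>p\<^sup>r\<close>, which is absurd (\<open>inverse_prime_power_not_sum\<close>).
\<close>

section \<open>The group \<open>\<int>\<^sup>2\<close>\<close>

lemma Z2_mult: "x \<otimes>\<^bsub>Z2\<^esub> y = x + y"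
  by (simp add: DirProd_def case_prod_unfold plus_prod_def)

lemma Z2_group: "group Z2"
  by (intro DirProd_group group_integer_group)

lemma Z2_inv: "inv\<^bsub>Z2\<^esub> x = - x"
  using inv_DirProd[of integer_group integer_group "fst x" "snd x"] by (simp add: uminus_prod_def)

lemma subgroup_Z2_diff:
  assumes "subgroup L Z2" "x \<in> L" "y \<in> L"
  shows "x - y \<in> L"
proof -
  have "x \<otimes>\<^bsub>Z2\<^esub> inv\<^bsub>Z2\<^esub> y \<in> L"
    using assms by (intro subgroup.m_closed subgroup.m_inv_closed)
  then show ?thesis by (simp add: Z2_mult Z2_inv)
qed

lemma subgroup_Z2_zero: "subgroup L Z2 \<Longrightarrow> 0 \<in> L"
  using subgroup.one_closed[of L Z2] by (simp add: zero_prod_def)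

lemma subgroup_Z2_add:
  assumes "subgroup L Z2" "x \<in> L" "y \<in> L"
  shows "x + y \<in> L"
  using subgroup.m_closed[OF assms] by (simp only: Z2_mult)

lemma subgroup_Z2_add_cancel:
  assumes "subgroup L Z2" "y \<in> L"
  shows "x + y \<in> L \<longleftrightarrow> x \<in> L"
  using subgroup_Z2_add[OF assms(1) _ assms(2)] subgroup_Z2_diff[OF assms(1) _ assms(2)]
  by (metis add_diff_cancel_right')

lemma subgroup_Z2_scale:
  assumes L: "subgroup L Z2" and "(x, y) \<in> L"
  shows "(c * x, c * y) \<in> L"
proof -
  have nat: "(int k * x, int k * y) \<in> L" for k
  proof (induction k)
    case 0
    show ?case using subgroup_Z2_zero[OF L] by (simp add: zero_prod_def)
  next
    case (Suc k)
    from subgroup_Z2_add[OF L Suc assms(2)] show ?case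
      by (simp add: algebra_simps)
  qed
  show ?thesis
  proof (cases "c \<ge> 0")
    case True
    then show ?thesis using nat[of "nat c"] by simp
  next
    case False
    then show ?thesis
      using subgroup_Z2_diff[OF L subgroup_Z2_zero[OF L] nat[of "nat (- c)"]]
      by (simp add: zero_prod_def)
  qed
qed

lemma lcoset_Z2: "v <#\<^bsub>Z2\<^esub> L = {w. w - v \<in> L}"
proof (rule Set.set_eqI)
  fix w
  have "w \<in> v <#\<^bsub>Z2\<^esub> L \<longleftrightarrow> (\<exists>h\<in>L. w = v + h)"
    unfolding l_coset_def Z2_mult by blast
  also have "\<dots> \<longleftrightarrow> w - v \<in> L"
    by (metis add_diff_cancel_left' add.commute diff_add_cancel)
  finally show "w \<in> v <#\<^bsub>Z2\<^esub> L \<longleftrightarrow> w \<in> {w. w - v \<in> L}" by simp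
qed

lemma rcosets_Z2: "rcosets\<^bsub>Z2\<^esub> L = range (\<lambda>v. {w. w - v \<in> L})"
proof -
  have "L #>\<^bsub>Z2\<^esub> v = {w. w - v \<in> L}" for v
  proof (rule Set.set_eqI)
    fix w
    have "w \<in> L #>\<^bsub>Z2\<^esub> v \<longleftrightarrow> (\<exists>h\<in>L. w = h + v)"
      unfolding r_coset_def Z2_mult by blast
    also have "\<dots> \<longleftrightarrow> w - v \<in> L"
      by (metis add_diff_cancel_right' diff_add_cancel)
    finally show "w \<in> L #>\<^bsub>Z2\<^esub> v \<longleftrightarrow> w \<in> {w. w - v \<in> L}" by simp
  qed
  then show ?thesis unfolding RCOSETS_def by auto
qed

lemma coset_eq_iff:
  assumes "subgroup L Z2"
  shows "{w. w - u \<in> L} = {w. w - v \<in> L} \<longleftrightarrow> u - v \<in> L"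
proof
  assume eq: "{w. w - u \<in> L} = {w. w - v \<in> L}"
  have "u \<in> {w. w - u \<in> L}" using subgroup_Z2_zero[OF assms] by simp
  then show "u - v \<in> L" unfolding eq by simp
next
  assume "u - v \<in> L"
  from subgroup_Z2_add_cancel[OF assms this] have "w - u \<in> L \<longleftrightarrow> w - v \<in> L" for w
    by (metis diff_add_cancel add_diff_eq)
  then show "{w. w - u \<in> L} = {w. w - v \<in> L}" by simp
qed

section \<open>Hermite normal form\<close>

lemma int_subgroup_multiples:
  fixes A :: "int set"
  assumes diff: "\<And>x y. x \<in> A \<Longrightarrow> y \<in> A \<Longrightarrow> x - y \<in> A" and "k \<in> A" "k \<noteq> 0"
  obtains a where "a > 0" "\<And>x. x \<in> A \<longleftrightarrow> a dvd x"
proof -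
  have zero: "0 \<in> A" using diff[OF assms(2,2)] by simp
  have "\<bar>k\<bar> \<in> A" using diff[OF zero assms(2)] assms(2) by (auto simp: abs_if)
  then have ex: "\<exists>m. m > 0 \<and> int m \<in> A" using assms(3) by (intro exI[of _ "nat \<bar>k\<bar>"]) auto
  define m where "m = (LEAST m. m > 0 \<and> int m \<in> A)"
  have m: "m > 0" "int m \<in> A"
    using LeastI_ex[OF ex] unfolding m_def by auto
  have least: "m \<le> l" if "l > 0" "int l \<in> A" for l
    unfolding m_def by (rule Least_le) (use that in auto)
  have add: "x + y \<in> A" if "x \<in> A" "y \<in> A" for x y
    using diff[OF that(1) diff[OF zero that(2)]] by simp
  have nat: "int m * int j \<in> A" for j
    by (induction j) (auto simp: zero algebra_simps intro: add m)
  have mult: "int m * c \<in> A" for c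
  proof (cases "c \<ge> 0")
    case True
    then show ?thesis using nat[of "nat c"] by simp
  next
    case False
    then show ?thesis using diff[OF zero nat[of "nat (- c)"]] by simp
  qed
  have "int m dvd x" if "x \<in> A" for x
  proof (rule ccontr)
    assume "\<not> int m dvd x"
    then have "x mod int m \<noteq> 0" by (simp add: dvd_eq_mod_eq_0)
    moreover have "x mod int m \<ge> 0" "x mod int m < int m" using m by auto
    moreover have "x mod int m \<in> A"
      using diff[OF that mult[of "x div int m"]] by (simp add: minus_mult_div_eq_mod)
    ultimately show False using least[of "nat (x mod int m)"] by auto
  qed
  then have "x \<in> A \<longleftrightarrow> int m dvd x" for x using mult by (auto elim: dvdE)
  with m show ?thesis by (intro that[of "int m"]) auto
qed

text \<open>
  The lattice spanned by the rows \<open>(a, b)\<close> and \<open>(0, d)\<close> of a triangular matrix.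
\<close>

definition hermite :: "int \<Rightarrow> int \<Rightarrow> int \<Rightarrow> (int \<times> int) set" where
  "hermite a b d = {(a * k, b * k + d * m) |k m. True}"

lemma mem_hermite: "(x, y) \<in> hermite a b d \<longleftrightarrow> (\<exists>k. x = a * k \<and> d dvd y - b * k)"
proof
  assume "(x, y) \<in> hermite a b d"
  then show "\<exists>k. x = a * k \<and> d dvd y - b * k" unfolding hermite_def by auto
next
  assume "\<exists>k. x = a * k \<and> d dvd y - b * k"
  then obtain k where "x = a * k" "d dvd y - b * k" by blast
  moreover from this(2) obtain m where "y - b * k = d * m" by (elim dvdE)
  ultimately have "(x, y) = (a * k, b * k + d * m)" by simp
  then show "(x, y) \<in> hermite a b d" unfolding hermite_def by blast
qed

text \<open>
  By the pigeonhole principle two multiples of \<open>(x, y)\<close> lie in the same of the finitely many cosets.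
\<close>

lemma sublattice_multiple_mem:
  assumes "sublattice L"
  obtains k where "k \<noteq> 0" "(k * x, k * y) \<in> L"
proof -
  have L: "subgroup L Z2" and fin: "finite (rcosets\<^bsub>Z2\<^esub> L)"
    using assms unfolding sublattice_def by auto
  define f where "f k = {w. w - (int k * x, int k * y) \<in> L}" for k :: nat
  have "finite (range f)"
    by (rule finite_subset[OF _ fin]) (auto simp: rcosets_Z2 f_def)
  then have "\<not> inj f" using finite_imageD infinite_UNIV_nat by blast
  then obtain i j where ij: "f i = f j" "i \<noteq> j" unfolding inj_def by blast
  then have "(int i * x, int i * y) - (int j * x, int j * y) \<in> L"
    unfolding f_def coset_eq_iff[OF L] by simp
  then have "((int i - int j) * x, (int i - int j) * y) \<in> L"
    by (simp add: algebra_simps)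
  then show ?thesis using ij(2) by (intro that[of "int i - int j"]) auto
qed

text \<open>
  The first coordinates of \<open>L\<close> form a group \<open>a\<int>\<close>, and the second coordinates of the vectors
  \<open>(0, y)\<close> of \<open>L\<close> form a group \<open>d\<int>\<close>; finite index makes both nonzero. Any \<open>(a, b) \<in> L\<close> together with
  \<open>(0, d)\<close> then spans \<open>L\<close>.
\<close>

lemma sublattice_hermite_basis:
  assumes "sublattice L"
  obtains a b d where "a > 0" "d > 0" "L = hermite a b d"
proof -
  have L: "subgroup L Z2" using assms unfolding sublattice_def by auto
  obtain k where k: "k \<noteq> 0" "(k * 1, k * 0) \<in> L"
    by (rule sublattice_multiple_mem[OF assms, of 1 0])
  obtain a where a: "a > 0" "\<And>x. x \<in> fst ` L \<longleftrightarrow> a dvd x"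
  proof (rule int_subgroup_multiples[of "fst ` L" k])
    fix x y assume "x \<in> fst ` L" "y \<in> fst ` L"
    then show "x - y \<in> fst ` L"
      using subgroup_Z2_diff[OF L] by (metis (no_types, lifting) fst_diff image_iff)
  next
    show "k \<in> fst ` L" using k(2) by force
  qed (use k in auto)
  obtain l where l: "l \<noteq> 0" "(l * 0, l * 1) \<in> L"
    by (rule sublattice_multiple_mem[OF assms, of 0 1])
  obtain d where d: "d > 0" "\<And>y. y \<in> {y. (0, y) \<in> L} \<longleftrightarrow> d dvd y"
  proof (rule int_subgroup_multiples[of "{y. (0, y) \<in> L}" l])
    fix x y assume "x \<in> {y. (0, y) \<in> L}" "y \<in> {y. (0, y) \<in> L}"
    then show "x - y \<in> {y. (0, y) \<in> L}"
      using subgroup_Z2_diff[OF L, of "(0, x)" "(0, y)"] by simp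
  qed (use l in auto)
  have "a \<in> fst ` L" using a by simp
  then obtain b where b: "(a, b) \<in> L" by force
  have "(x, y) \<in> L \<longleftrightarrow> (x, y) \<in> hermite a b d" for x y
  proof -
    have "(a * j, y) \<in> L \<longleftrightarrow> d dvd y - b * j" for j
    proof -
      have "(a * j, b * j) \<in> L" using subgroup_Z2_scale[OF L b, of j] by (simp add: mult.commute)
      from subgroup_Z2_add_cancel[OF L this, of "(0, y - b * j)"]
      show ?thesis using d(2) by simp
    qed
    moreover have "\<exists>j. x = a * j" if "(x, y) \<in> L"
      using a(2)[of x] that by (force elim: dvdE)
    ultimately show ?thesis unfolding mem_hermite by blast
  qed
  then have "L = hermite a b d" by auto
  with a(1) d(1) show ?thesis by (rule that)
qed

text \<open>
  The points of the rectangle \<open>[0, a) \<times> [0, d)\<close> represent each coset exactly once: reduce the first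
  coordinate with \<open>(a, b)\<close>, then the second one with \<open>(0, d)\<close>.
\<close>

lemma hermite_det:
  assumes L: "subgroup (hermite a b d) Z2" and "a > 0" "d > 0"
  shows "int (lattice_det (hermite a b d)) = a * d"
proof -
  let ?H = "hermite a b d"
  let ?c = "\<lambda>v. {w. w - v \<in> ?H}"
  have "bij_betw ?c ({0..<a} \<times> {0..<d}) (rcosets\<^bsub>Z2\<^esub> ?H)"
    unfolding bij_betw_def
  proof
    show "inj_on ?c ({0..<a} \<times> {0..<d})"
    proof (rule inj_onI)
      fix u v
      assume uv: "u \<in> {0..<a} \<times> {0..<d}" "v \<in> {0..<a} \<times> {0..<d}" "?c u = ?c v"
      obtain i j i' j' where u: "u = (i, j)" and v: "v = (i', j')" by fastforce
      have r: "i \<in> {0..<a}" "i' \<in> {0..<a}" "j \<in> {0..<d}" "j' \<in> {0..<d}"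
        using uv unfolding u v by auto
      from uv(3) have "(i - i', j - j') \<in> ?H" unfolding u v coset_eq_iff[OF L] by simp
      then obtain k where k: "i - i' = a * k" "d dvd j - j' - b * k" unfolding mem_hermite by auto
      have "a dvd i - i'" using k by simp
      then have i: "i = i'" using r by (simp add: zdvd_imp_le mod_eq_dvd_iff[symmetric])
      then have "k = 0" using k assms by simp
      then have "d dvd j - j'" using k by simp
      then have "j = j'" using r by (simp add: mod_eq_dvd_iff[symmetric])
      with i show "u = v" unfolding u v by simp
    qed
    show "?c ` ({0..<a} \<times> {0..<d}) = rcosets\<^bsub>Z2\<^esub> ?H"
      unfolding rcosets_Z2
    proof (intro equalityI image_subsetI)
      fix v :: "int \<times> int"
      obtain x y where v: "v = (x, y)" by (cases v)
      define k where "k = x div a"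
      define j where "j = (y - b * k) mod d"
      have "(x mod a - x, j - y) \<in> ?H"
        unfolding mem_hermite
      proof (intro exI conjI)
        show "x mod a - x = a * (- k)"
          unfolding k_def by (simp add: minus_mult_div_eq_mod[symmetric])
        have "d dvd j - (y - b * k)" unfolding j_def by (simp add: mod_eq_dvd_iff[symmetric])
        then show "d dvd j - y - b * (- k)" by (simp add: algebra_simps)
      qed
      then have "?c (x mod a, j) = ?c v" unfolding coset_eq_iff[OF L] v by simp
      moreover have "(x mod a, j) \<in> {0..<a} \<times> {0..<d}" unfolding j_def using assms by simp
      ultimately show "?c v \<in> ?c ` ({0..<a} \<times> {0..<d})" by blast
    qed auto
  qed
  then have "lattice_det ?H = card ({0..<a} \<times> {0..<d})"
    unfolding lattice_det_def by (simp add: bij_betw_same_card)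
  then show ?thesis using assms by (simp add: card_cartesian_product)
qed

lemma hermite_multiplicity:
  assumes L: "subgroup (hermite a b d) Z2"
  shows "int (lattice_multiplicity (hermite a b d)) = gcd a (gcd b d)"
proof -
  let ?H = "hermite a b d" and ?G = "generate Z2 {(a, b), (0, d)}"
  have "(a, b) \<in> ?H" unfolding mem_hermite by (rule exI[of _ 1]) simp
  moreover have "(0, d) \<in> ?H" unfolding mem_hermite by (rule exI[of _ 0]) simp
  ultimately have "?G \<subseteq> ?H"
    by (intro group.generate_subgroup_incl[OF Z2_group _ L]) simp
  moreover have "?H \<subseteq> ?G"
  proof
    have G: "subgroup ?G Z2"
      by (rule group.generate_is_subgroup[OF Z2_group]) simp
    fix w assume "w \<in> ?H"
    then obtain k m where w: "w = (a * k, b * k + d * m)" unfolding hermite_def by blast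
    have "(a, b) \<in> ?G" "(0, d) \<in> ?G" by (auto intro: generate.incl)
    from this[THEN subgroup_Z2_scale[OF G]] have "(k * a, k * b) \<in> ?G" "(m * 0, m * d) \<in> ?G"
      by blast+
    from subgroup_Z2_add[OF G this] show "w \<in> ?G" unfolding w by (simp add: mult.commute)
  qed
  ultimately have "?H = ?G" by blast
  from lattice_multiplicity_eq[OF this] show ?thesis by simp
qed

text \<open>
  Pulling the multiplicity \<open>e\<close> out of the basis gives \<open>L = e L'\<close> with \<open>L'\<close> of multiplicity one. In this
  form \<open>det L / e\<close> is visibly the integer \<open>e * (a * d)\<close>.
\<close>

lemma sublattice_normal_form:
  assumes "sublattice L"
  obtains e a b d where "e > 0" "a > 0" "d > 0" "gcd a (gcd b d) = 1"
    and "L = hermite (e * a) (e * b) (e * d)"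
    and "int (lattice_det L) = e * (e * (a * d))" "int (lattice_multiplicity L) = e"
proof -
  obtain A B D where AD: "A > 0" "D > 0" and L: "L = hermite A B D"
    by (rule sublattice_hermite_basis[OF assms])
  have sub: "subgroup (hermite A B D) Z2" using assms L unfolding sublattice_def by auto
  define e where "e = gcd A (gcd B D)"
  have e: "e > 0" "e dvd A" "e dvd B" "e dvd D" unfolding e_def using AD by (auto intro: dvd_trans)
  then obtain a b d where abd: "A = e * a" "B = e * b" "D = e * d" by (auto elim!: dvdE)
  have "gcd (e * a) (gcd (e * b) (e * d)) = e" using e_def[symmetric] unfolding abd .
  then have "e * gcd a (gcd b d) = e"
    using e(1) by (simp flip: gcd_mult_distrib_int)
  then have prim: "gcd a (gcd b d) = 1" using e(1) by simp
  have pos: "a > 0" "d > 0" using AD e(1) unfolding abd by (simp_all add: zero_less_mult_iff)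
  have det: "int (lattice_det L) = e * (e * (a * d))"
    unfolding L hermite_det[OF sub AD] by (simp add: abd)
  have mult: "int (lattice_multiplicity L) = e"
    unfolding L hermite_multiplicity[OF sub] e_def ..
  show ?thesis by (rule that[OF e(1) pos prim L[unfolded abd] det mult])
qed

lemma det_multiple_mem:
  assumes "sublattice L" "int (lattice_det L) dvd k"
  shows "(k * x, k * y) \<in> L"
proof -
  obtain e a b d where f: "L = hermite (e * a) (e * b) (e * d)"
    "int (lattice_det L) = e * (e * (a * d))"
    by (rule sublattice_normal_form[OF assms(1)])
  obtain c where "k = e * (e * (a * d)) * c" using assms(2) unfolding f(2) by (auto elim: dvdE)
  then show ?thesis unfolding f(1) mem_hermite
    by (intro exI[of _ "e * d * c * x"]) (auto simp: algebra_simps)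
qed

section \<open>A primitive functional\<close>

text \<open>
  Let \<open>t\<close> be the product of the primes that divide \<open>a\<close> but not \<open>b\<close>. A prime divisor of \<open>a\<close> then divides
  exactly one of \<open>b\<close> and \<open>t * d\<close>: if it divides \<open>b\<close>, it divides neither \<open>d\<close> nor \<open>t\<close>.
\<close>

lemma exists_coprime_shift:
  fixes a b d :: int
  assumes "a \<noteq> 0" "gcd a (gcd b d) = 1"
  obtains t where "coprime (t * d - b) a"
proof
  define t where "t = \<Prod>{q \<in> prime_factors a. \<not> q dvd b}"
  show "coprime (t * d - b) a"
  proof (rule ccontr)
    assume "\<not> coprime (t * d - b) a"
    then have "\<not> is_unit (gcd (t * d - b) a)" by (simp add: coprime_iff_gcd_eq_1)
    moreover have "gcd (t * d - b) a \<noteq> 0" using assms(1) by simp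
    ultimately obtain q where "prime q" "q dvd gcd (t * d - b) a"
      using prime_divisor_exists by blast
    then have q: "prime q" "q dvd t * d - b" "q dvd a" by simp_all
    have qa: "q \<in> prime_factors a" using q assms(1) by (simp add: in_prime_factors_iff)
    show False
    proof (cases "q dvd b")
      case False
      then have "q dvd t" unfolding t_def using qa by (intro dvd_prodI) auto
      then have "q dvd t * d" by simp
      with q(2) False show False using dvd_diff_right_iff by blast
    next
      case True
      then have "q dvd t * d" using q(2) by (simp add: dvd_diff_left_iff)
      moreover have "\<not> q dvd t"
      proof
        assume "q dvd t"
        then obtain q' where "q' \<in> prime_factors a" "\<not> q' dvd b" "q dvd q'"
          unfolding t_def using q(1) by (auto simp: prime_dvd_prod_iff)
        then show False using True q(1) primes_dvd_imp_eq[of q q'] by auto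
      qed
      ultimately have "q dvd d" using q(1) by (simp add: prime_dvd_mult_iff)
      then have "q dvd 1" using True q(3) assms(2) by (metis gcd_greatest)
      then show False using q(1) not_prime_unit by blast
    qed
  qed
qed

definition functional :: "int \<Rightarrow> int \<Rightarrow> int \<times> int \<Rightarrow> int" where
  "functional s t w = s * fst w + t * snd w"

lemma functional_add: "functional s t (u + w) = functional s t u + functional s t w"
  by (simp add: functional_def algebra_simps)

lemma functional_scale: "functional s t (c * x, c * y) = c * functional s t (x, y)"
  by (simp add: functional_def algebra_simps)

text \<open>
  The functionals killing \<open>(a, b)\<close> and \<open>(0, d)\<close> modulo their determinant \<open>a * d\<close> are the combinations
  of \<open>w \<mapsto> det ((a, b), w)\<close> and \<open>w \<mapsto> det (w, (0, d))\<close>; the one with coefficients \<open>1\<close> and \<open>c\<close> has the coordinates \<open>(c * d - b, a)\<close>, so \<open>c\<close> only has to make these coprime. Coprimality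
  makes the functional surjective modulo every integer.
\<close>

lemma exists_primitive_functional:
  fixes e a b d :: int
  assumes "a > 0" "gcd a (gcd b d) = 1"
  obtains s t where "coprime s t"
    and "\<And>w. w \<in> hermite (e * a) (e * b) (e * d) \<Longrightarrow> e * (a * d) dvd functional s t w"
proof -
  obtain c where c: "coprime (c * d - b) a"
    using exists_coprime_shift[of a b d] assms by auto
  show ?thesis
  proof (rule that[OF c])
    fix w assume "w \<in> hermite (e * a) (e * b) (e * d)"
    then obtain k m where "w = (e * a * k, e * b * k + e * d * m)" unfolding hermite_def by blast
    then have "functional (c * d - b) a w = e * (a * d) * (c * k + m)"
      by (simp add: functional_def algebra_simps)
    then show "e * (a * d) dvd functional (c * d - b) a w" by simp
  qed
qed

text \<open>
  The quotient by the lattice has exponent \<open>e * (a * d)\<close>, and the functional makes \<open>\<int>/N\<close> a further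
  quotient of it; so \<open>N\<close> divides this exponent, and must equal it if it is not smaller. In that case
  the lattice \<open>L'\<close> without the factor \<open>e\<close> has index \<open>a * d = N / e\<close>, the same as the kernel of the
  functional modulo \<open>N / e\<close>, which contains it. Thus \<open>L'\<close> is this kernel, and the lattice itself is
  determined by \<open>e\<close> and the functional.
\<close>

lemma hermite_eq_of_le_kernel:
  fixes e a b d N s t :: int
  assumes pos: "e > 0" "a > 0" "d > 0" and prim: "gcd a (gcd b d) = 1" and st: "coprime s t"
    and sub: "\<And>w. w \<in> hermite (e * a) (e * b) (e * d) \<Longrightarrow> N dvd functional s t w"
    and le: "e * (a * d) \<le> N"
  shows "N = e * (a * d)"
    and "hermite (e * a) (e * b) (e * d) = {w. e dvd fst w \<and> e dvd snd w \<and> N dvd functional s t w}"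
proof -
  have "(e * a, e * b) \<in> hermite (e * a) (e * b) (e * d)"
    unfolding mem_hermite by (rule exI[of _ 1]) simp
  from sub[OF this] have 1: "N dvd e * (s * a + t * b)"
    by (simp add: functional_def algebra_simps)
  have "(0, e * d) \<in> hermite (e * a) (e * b) (e * d)"
    unfolding mem_hermite by (rule exI[of _ 0]) simp
  from sub[OF this] have 2: "N dvd e * (t * d)" by (simp add: functional_def algebra_simps)
  \<comment> \<open>Cramer's rule: eliminate \<open>t\<close>, so that \<open>N\<close> divides \<open>e * (a * d)\<close> times each coordinate.\<close>
  have "N dvd e * (s * a + t * b) * d - e * (t * d) * b"
    by (rule dvd_diff[OF dvd_mult2[OF 1] dvd_mult2[OF 2]])
  then have "N dvd e * (a * d) * s" by (simp add: algebra_simps)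
  moreover have "N dvd e * (a * d) * t" using dvd_mult2[OF 2, of a] by (simp add: algebra_simps)
  ultimately have "N dvd gcd (e * (a * d) * s) (e * (a * d) * t)" by (rule gcd_greatest)
  also have "gcd (e * (a * d) * s) (e * (a * d) * t) = e * (a * d)"
    using st pos by (simp add: gcd_mult_distrib_int[symmetric] coprime_iff_gcd_eq_1)
  finally have "N dvd e * (a * d)" .
  then show N: "N = e * (a * d)"
    using le pos zdvd_imp_le[of N "e * (a * d)"] by simp
  have 1: "a * d dvd s * a + t * b" and "a * d dvd t * d" using 1 2 pos unfolding N by auto
  then have "a dvd t" using pos by simp
  then obtain t' where t': "t = a * t'" by (elim dvdE)
  have d: "d dvd s + t' * b"
  proof -
    have "a * d dvd a * (s + t' * b)" using 1 unfolding t' by (simp add: algebra_simps)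
    then show ?thesis using pos by simp
  qed
  have "coprime a s" using st unfolding t' by (simp add: coprime_commute)
  have "coprime d t'"
  proof (rule coprimeI)
    fix c assume c: "c dvd d" "c dvd t'"
    have "c dvd s + t' * b" using c d by (blast intro: dvd_trans)
    then have "c dvd s" using c by (simp add: dvd_add_left_iff)
    moreover have "c dvd t" using c t' by simp
    ultimately show "is_unit c" using st by (meson coprime_common_divisor)
  qed
  have mem: "(e * x, e * y) \<in> hermite (e * a) (e * b) (e * d)"
    if "N dvd functional s t (e * x, e * y)" for x y
  proof -
    have "e * (a * d) dvd e * (s * x + t * y)"
      using that unfolding N by (simp add: functional_def algebra_simps)
    then have dvd: "a * d dvd s * x + t * y" using pos by simp
    then have "a dvd s * x + a * (t' * y)" unfolding t' by (metis dvd_mult_left mult.assoc)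
    then have "a dvd s * x" by (simp add: dvd_add_left_iff)
    then have "a dvd x" using \<open>coprime a s\<close> by (simp add: coprime_dvd_mult_right_iff)
    then obtain k where k: "x = a * k" by (elim dvdE)
    have "a * d dvd a * (s * k + t' * y)" using dvd unfolding t' k by (simp add: algebra_simps)
    then have "d dvd s * k + t' * y" using pos by simp
    moreover have "d dvd (s + t' * b) * k" using d by simp
    ultimately have "d dvd (s * k + t' * y) - (s + t' * b) * k" by (rule dvd_diff)
    then have "d dvd t' * (y - b * k)" by (simp add: algebra_simps)
    then have "d dvd y - b * k" using \<open>coprime d t'\<close> by (simp add: coprime_dvd_mult_right_iff)
    then have "e * d dvd e * (y - b * k)" by simp
    then show ?thesis unfolding mem_hermite k
      by (intro exI[of _ k]) (simp add: algebra_simps)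
  qed
  show "hermite (e * a) (e * b) (e * d) = {w. e dvd fst w \<and> e dvd snd w \<and> N dvd functional s t w}"
  proof (intro equalityI subsetI)
    fix w assume w: "w \<in> hermite (e * a) (e * b) (e * d)"
    then obtain k m where "w = (e * a * k, e * b * k + e * d * m)" unfolding hermite_def by blast
    then have "e dvd fst w" "e dvd snd w" by (auto simp: mult.assoc)
    with sub[OF w] show "w \<in> {w. e dvd fst w \<and> e dvd snd w \<and> N dvd functional s t w}" by simp
  next
    fix w assume "w \<in> {w. e dvd fst w \<and> e dvd snd w \<and> N dvd functional s t w}"
    then show "w \<in> hermite (e * a) (e * b) (e * d)"
      by (cases w) (auto elim!: dvdE intro: mem)
  qed
qed

section \<open>A weight that cancels on cosets of nontrivial subgroups\<close>

text \<open>
  For an \<open>N\<close>-periodic \<open>g\<close> and a prime divisor \<open>q\<close> of \<open>N\<close>, this says that \<open>g\<close> sums to zero over each coset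
  of the subgroup of order \<open>q\<close> of \<open>\<int>/N\<close>. As every nontrivial subgroup contains one of prime order,
  these are the only cosets that need to be considered.
\<close>

definition balanced :: "int \<Rightarrow> (int \<Rightarrow> int) \<Rightarrow> int \<Rightarrow> bool" where
  "balanced N g q \<longleftrightarrow> (\<forall>x. (\<Sum>j<nat q. g (x + int j * (N div q))) = 0)"

text \<open>
  In the group ring of \<open>\<int>/N\<close> this weight is the product of \<open>1 - X\<^bsup>N/q\<^esup>\<close> over the primes \<open>q\<close> dividing
  \<open>N\<close>: each factor makes the weight balanced for its prime, because the sum over a coset telescopes,
  and later factors keep this property. The coefficient at \<open>0\<close> stays \<open>1\<close> because no cancellation
  reaches it: with the factors for \<open>Q\<close> the support lies in the subgroup killed by \<open>\<Prod>Q\<close>, and this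
  contains no element of order \<open>q\<close> for a new prime \<open>q\<close>.
\<close>

lemma exists_balanced_weight:
  fixes N :: int
  assumes "N > 0"
  obtains g where "g 0 = 1" "\<And>x y. N dvd x - y \<Longrightarrow> g x = g y"
    and "\<And>q. prime q \<Longrightarrow> q dvd N \<Longrightarrow> balanced N g q"
proof -
  have "\<exists>g. g 0 = (1::int) \<and> (\<forall>x y. N dvd x - y \<longrightarrow> g x = g y) \<and>
      (\<forall>x. g x \<noteq> 0 \<longrightarrow> N dvd \<Prod>Q * x) \<and> (\<forall>q\<in>Q. balanced N g q)"
    if "finite Q" "Q \<subseteq> prime_factors N" for Q
    using that
  proof (induction rule: finite_induct)
    case empty
    show ?case
    proof (intro exI[of _ "\<lambda>x. if N dvd x then 1 else 0"] conjI allI impI)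
      fix x y assume "N dvd x - y"
      then have "N dvd x \<longleftrightarrow> N dvd y" by (metis diff_add_cancel dvd_add_right_iff)
      then show "(if N dvd x then 1 else 0) = (if N dvd y then 1 else (0::int))" by simp
    qed (auto split: if_splits)
  next
    case (insert q Q)
    then obtain g where g0: "g 0 = (1::int)" and per: "\<And>x y. N dvd x - y \<Longrightarrow> g x = g y"
      and supp: "\<And>x. g x \<noteq> 0 \<Longrightarrow> N dvd \<Prod>Q * x" and bal: "\<And>q. q \<in> Q \<Longrightarrow> balanced N g q"
      by auto
    have q: "prime q" "q dvd N" "q > 0" using insert.prems by (auto simp: in_prime_factors_iff prime_gt_0_int)
    define M where "M = N div q"
    have M: "N = q * M" "M > 0" using q assms unfolding M_def
      by (auto simp: pos_imp_zdiv_pos_iff zdvd_imp_le)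
    define h where "h x = g x - g (x - M)" for x
    have "g (- M) = 0"
    proof (rule ccontr)
      assume "g (- M) \<noteq> 0"
      from supp[OF this] have "q dvd \<Prod>Q" using M by simp
      then obtain q' where "q' \<in> Q" "q dvd q'"
        using q insert.hyps by (auto simp: prime_dvd_prod_iff)
      moreover have "prime q'" using \<open>q' \<in> Q\<close> insert.prems by (auto simp: in_prime_factors_iff)
      ultimately show False using insert.hyps q primes_dvd_imp_eq[of q q'] by auto
    qed
    then have "h 0 = 1" by (simp add: h_def g0)
    moreover have "h x = h y" if "N dvd x - y" for x y
      unfolding h_def using per[of x y] per[of "x - M" "y - M"] that by simp
    moreover have "N dvd \<Prod>(insert q Q) * x" if hx: "h x \<noteq> 0" for x
    proof -
      consider "g x \<noteq> 0" | "g (x - M) \<noteq> 0" using hx unfolding h_def by (cases "g x = 0") auto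
      then have "N dvd q * \<Prod>Q * x"
      proof cases
        case 1
        from supp[OF this] have "N dvd q * (\<Prod>Q * x)" by simp
        then show ?thesis by (simp add: mult.assoc)
      next
        case 2
        from supp[OF this] have "N dvd q * (\<Prod>Q * (x - M))" by simp
        moreover have "q * (\<Prod>Q * (x - M)) = q * \<Prod>Q * x - N * \<Prod>Q"
          unfolding M(1) by (simp add: algebra_simps)
        ultimately show ?thesis by (metis dvd_diff_left_iff dvd_triv_left)
      qed
      then show ?thesis using insert.hyps by simp
    qed
    moreover have "balanced N h q'" if "q' \<in> insert q Q" for q'
    proof (cases "q' = q")
      case False
      with that bal have b: "balanced N g q'" by simp
      show ?thesis unfolding balanced_def
      proof
        fix x
        have "(\<Sum>j<nat q'. h (x + int j * (N div q'))) =
            (\<Sum>j<nat q'. g (x + int j * (N div q'))) - (\<Sum>j<nat q'. g ((x - M) + int j * (N div q')))"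
          by (simp add: h_def sum_subtractf algebra_simps)
        then show "(\<Sum>j<nat q'. h (x + int j * (N div q'))) = 0"
          using b unfolding balanced_def by simp
      qed
    next
      case True
      show ?thesis unfolding balanced_def True M_def[symmetric]
      proof
        fix x
        have "(\<Sum>j<m. h (x + int j * M)) = g (x + int m * M - M) - g (x - M)" for m
          by (induction m) (auto simp: h_def algebra_simps)
        moreover have "g (x + int (nat q) * M - M) = g (x - M)"
          using q by (intro per) (simp add: M(1))
        ultimately show "(\<Sum>j<nat q. h (x + int j * M)) = 0" by simp
      qed
    qed
    ultimately show ?case by blast
  qed
  from this[of "prime_factors N"] obtain g where "g 0 = (1::int)"
    "\<And>x y. N dvd x - y \<Longrightarrow> g x = g y" "\<And>q. q \<in> prime_factors N \<Longrightarrow> balanced N g q" by auto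
  then show ?thesis using assms by (intro that[of g]) (auto simp: in_prime_factors_iff)
qed

section \<open>Sums over a box\<close>

definition periodic :: "int \<Rightarrow> (int \<times> int \<Rightarrow> int) \<Rightarrow> bool" where
  "periodic K f \<longleftrightarrow> (\<forall>w x y. f (w + (K * x, K * y)) = f w)"

definition box_sum :: "int \<Rightarrow> (int \<times> int \<Rightarrow> int) \<Rightarrow> int" where
  "box_sum K f = (\<Sum>w\<in>{0..<K} \<times> {0..<K}. f w)"

text \<open>
  The box is a system of representatives of \<open>\<int>\<^sup>2\<close> modulo \<open>K\<close>, on which a translation acts as a
  permutation.
\<close>

lemma box_sum_shift:
  assumes "periodic K f" "K > 0"
  shows "box_sum K (\<lambda>w. f (w + u)) = box_sum K f"
proof -
  let ?B = "{0..<K} \<times> {0..<K}"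
  define T where "T u w = ((fst w + fst u) mod K, (snd w + snd u) mod K)" for u w :: "int \<times> int"
  have T: "T u w \<in> ?B" for u w unfolding T_def using assms(2) by simp
  have inv: "T (- u) (T u w) = w" "T u (T (- u) w) = w" if "w \<in> ?B" for w
    using that unfolding T_def by (auto simp: mod_simps)
  have "bij_betw (T u) ?B ?B"
    by (rule bij_betwI[where g = "T (- u)"]) (use T inv in auto)
  then have "(\<Sum>w\<in>?B. f (T u w)) = (\<Sum>w\<in>?B. f w)" by (rule sum.reindex_bij_betw)
  moreover have "f (T u w) = f (w + u)" for w
  proof -
    have "w + u = T u w + (K * ((fst w + fst u) div K), K * ((snd w + snd u) div K))"
      unfolding T_def by (simp add: prod_eq_iff)
    then show ?thesis using assms(1) unfolding periodic_def by metis
  qed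
  ultimately show ?thesis unfolding box_sum_def by simp
qed

lemma periodic_coset:
  assumes "subgroup L Z2" "\<And>x y. (K * x, K * y) \<in> L"
  shows "periodic K (\<lambda>w. of_bool (w - v \<in> L))"
  unfolding periodic_def
proof (intro allI)
  fix w x y
  have "w + (K * x, K * y) - v = (w - v) + (K * x, K * y)" by simp
  then have "w + (K * x, K * y) - v \<in> L \<longleftrightarrow> w - v \<in> L"
    by (simp only: subgroup_Z2_add_cancel[OF assms(1) assms(2)])
  then show "(of_bool (w + (K * x, K * y) - v \<in> L) :: int) = of_bool (w - v \<in> L)"
    by simp
qed

text \<open>
  The cosets of \<open>L\<close> partition the box, and being translates of each other they all meet it in the
  same number of points.
\<close>

lemma box_sum_coset:
  assumes "sublattice L" "int (lattice_det L) dvd K" "K > 0"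
  shows "int (lattice_det L) * box_sum K (\<lambda>w. of_bool (w - v \<in> L)) = K\<^sup>2"
proof -
  have L: "subgroup L Z2" and fin: "finite (rcosets\<^bsub>Z2\<^esub> L)"
    using assms unfolding sublattice_def by auto
  have per: "periodic K (\<lambda>w. of_bool (w - v \<in> L))" for v
    by (rule periodic_coset[OF L det_multiple_mem[OF assms(1,2)]])
  have indep: "box_sum K (\<lambda>w. of_bool (w - v' \<in> L)) = box_sum K (\<lambda>w. of_bool (w - v \<in> L))" for v'
    using box_sum_shift[OF per[of v'] assms(3), of "v' - v"] by (simp add: algebra_simps)
  have "(\<Sum>C\<in>rcosets\<^bsub>Z2\<^esub> L. of_bool (w \<in> C) :: int) = 1" for w
  proof -
    have "w \<in> C \<longleftrightarrow> C = {u. u - w \<in> L}" if "C \<in> rcosets\<^bsub>Z2\<^esub> L" for C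
    proof -
      from that obtain v' where C: "C = {u. u - v' \<in> L}" unfolding rcosets_Z2 by blast
      show ?thesis unfolding C by (metis coset_eq_iff[OF L] mem_Collect_eq)
    qed
    then have "(\<Sum>C\<in>rcosets\<^bsub>Z2\<^esub> L. of_bool (w \<in> C) :: int) =
        (\<Sum>C\<in>rcosets\<^bsub>Z2\<^esub> L. if C = {u. u - w \<in> L} then 1 else 0)"
      by (intro sum.cong) auto
    also have "\<dots> = 1" using fin by (simp add: rcosets_Z2)
    finally show ?thesis .
  qed
  then have "K\<^sup>2 = box_sum K (\<lambda>w. \<Sum>C\<in>rcosets\<^bsub>Z2\<^esub> L. of_bool (w \<in> C))"
    unfolding box_sum_def using assms(3) by (simp add: power2_eq_square)
  also have "\<dots> = (\<Sum>C\<in>rcosets\<^bsub>Z2\<^esub> L. box_sum K (\<lambda>w. of_bool (w \<in> C)))"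
    unfolding box_sum_def by (rule sum.swap)
  also have "\<dots> = (\<Sum>C\<in>rcosets\<^bsub>Z2\<^esub> L. box_sum K (\<lambda>w. of_bool (w - v \<in> L)))"
  proof (rule sum.cong[OF refl])
    fix C assume "C \<in> rcosets\<^bsub>Z2\<^esub> L"
    then obtain v' where C: "C = {u. u - v' \<in> L}" unfolding rcosets_Z2 by blast
    show "box_sum K (\<lambda>w. of_bool (w \<in> C)) = box_sum K (\<lambda>w. of_bool (w - v \<in> L))"
      using indep[of v'] unfolding C by simp
  qed
  also have "\<dots> = int (lattice_det L) * box_sum K (\<lambda>w. of_bool (w - v \<in> L))"
    unfolding lattice_det_def by simp
  finally show ?thesis by simp
qed

text \<open>
  The image of \<open>L\<close> in \<open>\<int>/N\<close> is a nontrivial subgroup, so it contains the subgroup of some prime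
  order \<open>q\<close>. Translating the sum by the vectors \<open>u j\<close> of \<open>L\<close> that map onto this subgroup changes neither
  the sum nor the coset, but averages the weight over a coset of that subgroup.
\<close>

lemma box_sum_weight_eq_0:
  assumes L: "subgroup L Z2" and KL: "\<And>x y. (K * x, K * y) \<in> L" and K: "K > 0" "N dvd K"
    and per: "\<And>x y. N dvd x - y \<Longrightarrow> g x = g y" and N: "N > 0"
    and bal: "\<And>q. prime q \<Longrightarrow> q dvd N \<Longrightarrow> balanced N g q"
    and l: "l \<in> L" "\<not> N dvd functional s t l"
  shows "box_sum K (\<lambda>w. of_bool (w - v \<in> L) * g (functional s t w + c)) = 0"
proof -
  let ?F = "\<lambda>w. of_bool (w - v \<in> L) * g (functional s t w + c)"
  define D where "D = gcd (functional s t l) N"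
  have "D dvd N" unfolding D_def by simp
  then obtain m where m: "N = D * m" by (elim dvdE)
  have "D > 0" unfolding D_def using N by simp
  then have "m > 0" using N m by (simp add: zero_less_mult_iff)
  have "m \<noteq> 1"
  proof
    assume "m = 1"
    then have "gcd (functional s t l) N = N" using m D_def by simp
    then show False using l(2) by (metis gcd_dvd1)
  qed
  then obtain q where q: "prime q" "q dvd m"
    using \<open>m > 0\<close> prime_divisor_exists[of m] by auto
  then have qN: "q dvd N" using m by simp
  define M where "M = N div q"
  have M: "N = q * M" unfolding M_def using qN by simp
  have "D dvd M"
  proof -
    from q(2) obtain m' where "m = q * m'" by (elim dvdE)
    then have "q * M = q * (D * m')" unfolding M[symmetric] m by (simp add: mult.left_commute)
    then have "M = D * m'" using prime_gt_0_int[OF q(1)] by simp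
    then show ?thesis by simp
  qed
  moreover obtain x y where "x * functional s t l + y * N = D"
    using bezout_int[of "functional s t l" N] unfolding D_def by blast
  ultimately obtain z where "M = (x * functional s t l + y * N) * z" by (auto elim: dvdE)
  then have xz: "N dvd (x * z) * functional s t l - M"
    by (intro dvdI[of _ _ "- y * z"]) (simp add: algebra_simps)
  define u where "u j = (int j * (x * z) * fst l, int j * (x * z) * snd l)" for j :: nat
  have uL: "u j \<in> L" for j
    unfolding u_def by (rule subgroup_Z2_scale[OF L]) (use l in simp)
  have perF: "periodic K ?F"
    unfolding periodic_def
  proof (intro allI)
    fix w a b
    have "N dvd (functional s t (w + (K * a, K * b)) + c) - (functional s t w + c)"
      using K(2) by (simp add: functional_add functional_scale)
    moreover have "(of_bool (w + (K * a, K * b) - v \<in> L) :: int) = of_bool (w - v \<in> L)"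
      using periodic_coset[OF L KL, of v] unfolding periodic_def by blast
    ultimately show "?F (w + (K * a, K * b)) = ?F w"
      using per by simp
  qed
  have F: "?F (w + u j) = of_bool (w - v \<in> L) * g (functional s t w + c + int j * M)" for w j
  proof -
    have "w + u j - v = (w - v) + u j" by simp
    then have "w + u j - v \<in> L \<longleftrightarrow> w - v \<in> L"
      using subgroup_Z2_add_cancel[OF L uL] by metis
    moreover have "g (functional s t (w + u j) + c) = g (functional s t w + c + int j * M)"
    proof (rule per)
      have "functional s t (u j) = int j * ((x * z) * functional s t l)"
        unfolding u_def functional_scale by simp
      then have "functional s t (w + u j) + c - (functional s t w + c + int j * M)
          = int j * ((x * z) * functional s t l - M)"
        by (simp add: functional_add algebra_simps)
      then show "N dvd functional s t (w + u j) + c - (functional s t w + c + int j * M)"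
        using xz by simp
    qed
    ultimately show ?thesis by simp
  qed
  have "q * box_sum K ?F = (\<Sum>j<nat q. box_sum K ?F)" using q(1) prime_gt_0_int[of q] by simp
  also have "\<dots> = (\<Sum>j<nat q. box_sum K (\<lambda>w. ?F (w + u j)))"
    using box_sum_shift[OF perF K(1)] by simp
  also have "\<dots> = (\<Sum>j<nat q. box_sum K (\<lambda>w. of_bool (w - v \<in> L) * g (functional s t w + c + int j * M)))"
    by (simp only: F)
  also have "\<dots> = box_sum K (\<lambda>w. of_bool (w - v \<in> L) * (\<Sum>j<nat q. g (functional s t w + c + int j * M)))"
    unfolding box_sum_def sum_distrib_left by (rule sum.swap)
  also have "\<dots> = 0"
    using bal[OF q(1) qN] unfolding balanced_def M_def box_sum_def by simp
  finally show ?thesis using q(1) by auto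
qed

section \<open>Fractions with denominators below a prime power\<close>

text \<open>
  A positive integer below \<open>p\<^sup>r\<close> is divisible by at most the \<open>(r - 1)\<close>-st power of \<open>p\<close>, so the sum has
  \<open>p\<close>-adic valuation greater than \<open>- r\<close>. Valuations are avoided by clearing denominators with
  \<open>m * p\<^bsup>r - 1\<^esup>\<close> where \<open>p\<close> does not divide \<open>m\<close>. For \<open>r = 0\<close> the sum is empty.
\<close>

lemma inverse_prime_power_not_sum:
  fixes p :: nat and e :: "'a \<Rightarrow> nat" and g :: "'a \<Rightarrow> int"
  assumes "prime p" "finite I" "\<And>i. i \<in> I \<Longrightarrow> 0 < e i \<and> e i < p ^ r"
  shows "(\<Sum>i\<in>I. real_of_int (g i) / real (e i)) \<noteq> 1 / real (p ^ r)"
proof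
  assume eq: "(\<Sum>i\<in>I. real_of_int (g i) / real (e i)) = 1 / real (p ^ r)"
  show False
  proof (cases r)
    case 0
    then have "I = {}" using assms(3) by fastforce
    then show False using eq 0 by simp
  next
    case (Suc k)
    have "\<exists>m. \<not> p dvd m \<and> (\<exists>z::int. real m * real (p ^ k) * (\<Sum>i\<in>I. real_of_int (g i) / real (e i)) = of_int z)"
      using assms(2,3)
    proof (induction rule: finite_induct)
      case empty
      show ?case using assms(1) by (intro exI[of _ 1]) (auto simp: prime_nat_iff)
    next
      case (insert i I)
      then obtain m z where m: "\<not> p dvd m"
        and z: "real m * real (p ^ k) * (\<Sum>i\<in>I. real_of_int (g i) / real (e i)) = of_int z" by auto
      have ei: "0 < e i" "e i < p ^ r" using insert.prems by auto
      obtain s m' where s: "e i = p ^ s * m'" "\<not> p dvd m'"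
        using ei(1) assms(1) by (metis multiplicity_decompose' not_prime_unit less_numeral_extra(3))
      have "p ^ s < p ^ r" using s ei by (metis dvd_triv_left dvd_imp_le le_less_trans)
      then have "s \<le> k" using assms(1) Suc by (metis less_Suc_eq_le power_less_imp_less_exp prime_gt_1_nat)
      then have pk: "p ^ k = p ^ s * p ^ (k - s)" by (simp flip: power_add)
      have "\<not> p dvd m * m'" using m s(2) assms(1) by (simp add: prime_dvd_mult_iff)
      moreover have "real (m * m') * real (p ^ k) * (real_of_int (g i) / real (e i))
          = of_int (int m * int (p ^ (k - s)) * g i)"
        using ei(1) prime_gt_0_nat[OF assms(1)] unfolding s(1) pk by simp
      then have "real (m * m') * real (p ^ k) * (\<Sum>i\<in>insert i I. real_of_int (g i) / real (e i))
          = of_int (int m * int (p ^ (k - s)) * g i + int m' * z)"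
        using insert.hyps z by (simp add: algebra_simps)
      ultimately show ?case by blast
    qed
    then obtain m z where m: "\<not> p dvd m" and "real m * real (p ^ k) * (1 / real (p ^ r)) = of_int z"
      unfolding eq by blast
    then have "real m = of_int z * real p"
      using assms(1) prime_gt_0_nat[of p] unfolding Suc by (simp add: field_simps)
    then have "int m = z * int p" by (metis of_int_eq_iff of_int_mult of_int_of_nat_eq)
    then have "int p dvd int m" by simp
    then show False using m by simp
  qed
qed

section \<open>Tilings whose leading multiplicity is a prime power\<close>

theorem theorem5p5:
  fixes n p r :: nat
    and L :: "nat \<Rightarrow> (int \<times> int) set"
    and v :: "nat \<Rightarrow> int \<times> int"
  assumes "n \<ge> 2"
    and "lattice_tiling n L v"
    and "\<And>i j. 1 \<le> i \<Longrightarrow> i < j \<Longrightarrow> j \<le> n \<Longrightarrow>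
           real (lattice_det (L i)) / real (lattice_multiplicity (L i))
             \<ge> real (lattice_det (L j)) / real (lattice_multiplicity (L j))"
    and "\<And>i j. 1 \<le> i \<Longrightarrow> i < j \<Longrightarrow> j \<le> n \<Longrightarrow>
           real (lattice_det (L i)) / real (lattice_multiplicity (L i))
             = real (lattice_det (L j)) / real (lattice_multiplicity (L j)) \<Longrightarrow>
           lattice_multiplicity (L i) \<ge> lattice_multiplicity (L j)"
    and "prime p"
    and "lattice_multiplicity (L 1) = p ^ r"
  shows "translational_property n L"
proof (rule ccontr)
  assume not_transl: "\<not> translational_property n L"
  have lat: "sublattice (L i)" if "i \<in> {1..n}" for i
    using assms(2) that unfolding lattice_tiling_def by blast
  then have grp: "subgroup (L i) Z2" if "i \<in> {1..n}" for i
    using that unfolding sublattice_def by blast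
  have one: "1 \<in> {1..n}" using assms(1) by simp
  define m where "m i = lattice_multiplicity (L i)" for i
  have ne: "L i \<noteq> L 1" if "i \<in> {1..n}" "i \<noteq> 1" for i
    using not_transl that one unfolding translational_property_def by blast

  \<comment> \<open>\<open>E i\<close> is the integer \<open>det (L i) / m i\<close>, the exponent of the quotient by \<open>L i\<close>.\<close>
  have "\<exists>N e a b d. e > 0 \<and> a > 0 \<and> d > 0 \<and> gcd a (gcd b d) = 1 \<and>
      L i = hermite (e * a) (e * b) (e * d) \<and> N = e * (a * d) \<and>
      int (lattice_det (L i)) = e * N \<and> int (m i) = e" if "i \<in> {1..n}" for i
    using sublattice_normal_form[OF lat[OF that]] unfolding m_def by metis
  then obtain E where E: "\<And>i. i \<in> {1..n} \<Longrightarrow> \<exists>e a b d. e > 0 \<and> a > 0 \<and> d > 0 \<and> gcd a (gcd b d) = 1 \<and>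
      L i = hermite (e * a) (e * b) (e * d) \<and> E i = e * (a * d) \<and>
      int (lattice_det (L i)) = e * E i \<and> int (m i) = e"
    by metis
  have m_pos: "m i > 0" and E_pos: "E i > 0" and det: "int (lattice_det (L i)) = int (m i) * E i"
    if "i \<in> {1..n}" for i
    using E[OF that] by auto
  have quot: "real (lattice_det (L i)) / real (lattice_multiplicity (L i)) = of_int (E i)"
    if "i \<in> {1..n}" for i
  proof -
    have "real (lattice_det (L i)) = real (m i) * of_int (E i)"
      using det[OF that] by (metis of_int_mult of_int_of_nat_eq)
    then show ?thesis using m_pos[OF that] unfolding m_def by simp
  qed
  define N where "N = E 1"
  have N: "N > 0" unfolding N_def using E_pos[OF one] .
  have E_le: "E i \<le> N" if "i \<in> {1..n}" for i
  proof (cases "i = 1")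
    case False
    then have "1 < i" "i \<le> n" using that by auto
    from assms(3)[OF order_refl this] show ?thesis
      unfolding quot[OF that] quot[OF one] N_def by simp
  qed (simp add: N_def)
  have m_le: "m i \<le> m 1" if "i \<in> {1..n}" "E i = N" for i
  proof (cases "i = 1")
    case False
    then have "1 < i" "i \<le> n" using that by auto
    from assms(4)[OF order_refl this] show ?thesis
      using quot[OF that(1)] quot[OF one] that(2) unfolding N_def m_def by simp
  qed simp

  obtain s t where st: "coprime s t" and ker1: "\<And>w. w \<in> L 1 \<Longrightarrow> N dvd functional s t w"
  proof -
    obtain e a b d where *: "a > 0" "gcd a (gcd b d) = 1"
      "L 1 = hermite (e * a) (e * b) (e * d)" "E 1 = e * (a * d)"
      using E[OF one] by (elim exE conjE) (rule that)
    show ?thesis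
      by (rule exists_primitive_functional[OF *(1,2), of e]) (use that * in \<open>auto simp: N_def\<close>)
  qed
  have kernel: "E i = N \<and> L i = {w. int (m i) dvd fst w \<and> int (m i) dvd snd w \<and> N dvd functional s t w}"
    if i: "i \<in> {1..n}" and ker: "\<And>w. w \<in> L i \<Longrightarrow> N dvd functional s t w" for i
  proof -
    obtain e a b d where *: "e > 0" "a > 0" "d > 0" "gcd a (gcd b d) = 1"
      "L i = hermite (e * a) (e * b) (e * d)" "E i = e * (a * d)" "int (m i) = e"
      using E[OF i] by (elim exE conjE) (rule that)
    note k = hermite_eq_of_le_kernel[OF *(1-4) st, of N]
    show ?thesis using k ker E_le[OF i] unfolding *(5-7) by auto
  qed

  define I where "I = {i \<in> {1..n}. \<forall>w\<in>L i. N dvd functional s t w}"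
  have I1: "1 \<in> I" unfolding I_def using one ker1 by blast
  have I_E: "E i = N" if "i \<in> I" for i using kernel that unfolding I_def by blast
  have I_less: "m i < m 1" if "i \<in> I - {1}" for i
  proof -
    have i: "i \<in> {1..n}" "\<And>w. w \<in> L i \<Longrightarrow> N dvd functional s t w" using that unfolding I_def by auto
    have "m i \<noteq> m 1"
    proof
      assume "m i = m 1"
      then have "L i = L 1" using kernel[OF i] kernel[OF one ker1] by simp
      then show False using ne[OF i(1)] that by simp
    qed
    moreover have "m i \<le> m 1" using m_le[OF i(1)] I_E that by simp
    ultimately show ?thesis by simp
  qed

  \<comment> \<open>Otherwise all quotients are trivial and every functional kills everything modulo \<open>N\<close>, so that
    the second sublattice falls under \<open>I_less\<close>, although all multiplicities are \<open>1\<close>.\<close>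
  have "N \<noteq> 1"
  proof
    assume "N = 1"
    have two: "2 \<in> {1..n}" using assms(1) by simp
    have "m 2 < m 1" using I_less[of 2] two \<open>N = 1\<close> unfolding I_def by simp
    moreover have "int (m 1) dvd N"
      using E[OF one] unfolding N_def by (metis dvd_triv_left)
    ultimately show False using \<open>N = 1\<close> m_pos[OF two] by simp
  qed

  obtain g where g0: "g 0 = 1" and per: "\<And>x y. N dvd x - y \<Longrightarrow> g x = g y"
    and bal: "\<And>q. prime q \<Longrightarrow> q dvd N \<Longrightarrow> balanced N g q"
    by (rule exists_balanced_weight[OF N])
      (rule that, assumption, metis, metis)
  define K where "K = (\<Prod>i\<in>{1..n}. int (lattice_det (L i)))"
  have K: "K > 0" unfolding K_def using det m_pos E_pos by (intro prod_pos) simp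
  have det_K: "int (lattice_det (L i)) dvd K" if "i \<in> {1..n}" for i
    unfolding K_def using that by (intro dvd_prodI) auto
  have NK: "N dvd K" using det_K[OF one] det[OF one] unfolding N_def by (metis dvd_mult_right)
  \<comment> \<open>The shift places the weight \<open>g 0 = 1\<close> on the first translate.\<close>
  define c where "c = - functional s t (v 1)"
  define G where "G w = g (functional s t w + c)" for w

  \<comment> \<open>The whole group is a lattice with nontrivial image, so the filter applies to it.\<close>
  have "box_sum K G = 0"
  proof -
    obtain x y where xy: "functional s t (x, y) = 1"
      using bezout_int[of s t] st by (auto simp: functional_def mult.commute)
    have "box_sum K (\<lambda>w. of_bool (w - 0 \<in> UNIV) * g (functional s t w + c)) = 0"
    proof (rule box_sum_weight_eq_0[OF _ _ K NK per N bal, of UNIV "(x, y)"])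
      show "subgroup UNIV Z2" using group.subgroup_self[OF Z2_group] by simp
      show "\<not> N dvd functional s t (x, y)" using xy \<open>N \<noteq> 1\<close> N by auto
    qed auto
    then show ?thesis unfolding G_def by simp
  qed
  moreover have "(\<lambda>w. \<Sum>i\<in>{1..n}. of_bool (w - v i \<in> L i) * G w) = G"
  proof
    fix w
    have "w \<in> (\<Union>i\<in>{1..n}. v i <#\<^bsub>Z2\<^esub> L i)" using assms(2) unfolding lattice_tiling_def by simp
    then obtain i where i: "i \<in> {1..n}" "w - v i \<in> L i" unfolding lcoset_Z2 by blast
    have "w - v j \<in> L j \<longleftrightarrow> j = i" if "j \<in> {1..n}" for j
    proof
      assume j: "w - v j \<in> L j"
      show "j = i"
      proof (rule ccontr)
        assume "j \<noteq> i"
        then have "(v j <#\<^bsub>Z2\<^esub> L j) \<inter> (v i <#\<^bsub>Z2\<^esub> L i) = {}"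
          using assms(2) that i(1) unfolding lattice_tiling_def disjoint_family_on_def by blast
        then show False using i(2) j unfolding lcoset_Z2 by blast
      qed
    qed (use i in simp)
    then have "(\<Sum>j\<in>{1..n}. of_bool (w - v j \<in> L j) * G w) = (\<Sum>j\<in>{1..n}. if j = i then G w else 0)"
      by (intro sum.cong) auto
    then show "(\<Sum>i\<in>{1..n}. of_bool (w - v i \<in> L i) * G w) = G w" using i(1) by simp
  qed
  ultimately have "0 = box_sum K (\<lambda>w. \<Sum>i\<in>{1..n}. of_bool (w - v i \<in> L i) * G w)"
    by (simp only:)
  also have "\<dots> = (\<Sum>i\<in>{1..n}. box_sum K (\<lambda>w. of_bool (w - v i \<in> L i) * G w))"
    unfolding box_sum_def by (rule sum.swap)
  also have "\<dots> = (\<Sum>i\<in>I. box_sum K (\<lambda>w. of_bool (w - v i \<in> L i) * G w))"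
  proof (rule sum.mono_neutral_right)
    show "\<forall>i\<in>{1..n} - I. box_sum K (\<lambda>w. of_bool (w - v i \<in> L i) * G w) = 0"
    proof
      fix i assume "i \<in> {1..n} - I"
      then obtain l where i: "i \<in> {1..n}" and l: "l \<in> L i" "\<not> N dvd functional s t l"
        unfolding I_def by blast
      show "box_sum K (\<lambda>w. of_bool (w - v i \<in> L i) * G w) = 0" unfolding G_def
        by (rule box_sum_weight_eq_0[OF grp[OF i] det_multiple_mem[OF lat[OF i] det_K[OF i]] K NK per N bal l])
    qed
  qed (auto simp: I_def)
  finally have sum0: "(\<Sum>i\<in>I. box_sum K (\<lambda>w. of_bool (w - v i \<in> L i) * G w)) = 0" by simp

  have weighted_count: "real_of_int (box_sum K (\<lambda>w. of_bool (w - v i \<in> L i) * G w))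
      = (of_int K)\<^sup>2 / of_int N * (of_int (G (v i)) / real (m i))" if "i \<in> I" for i
  proof -
    have i: "i \<in> {1..n}" and ker: "\<And>w. w \<in> L i \<Longrightarrow> N dvd functional s t w"
      using that unfolding I_def by auto
    have const: "of_bool (w - v i \<in> L i) * G w = of_bool (w - v i \<in> L i) * G (v i)" for w
    proof (cases "w - v i \<in> L i")
      case True
      have "functional s t w = functional s t (w - v i) + functional s t (v i)"
        by (simp flip: functional_add)
      then have "N dvd (functional s t w + c) - (functional s t (v i) + c)" using ker[OF True] by simp
      then show ?thesis unfolding G_def using per by simp
    qed simp
    have "box_sum K (\<lambda>w. of_bool (w - v i \<in> L i) * G w)
        = box_sum K (\<lambda>w. of_bool (w - v i \<in> L i)) * G (v i)"
      unfolding box_sum_def by (subst const) (simp only: sum_distrib_right)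
    moreover have "real_of_int (box_sum K (\<lambda>w. of_bool (w - v i \<in> L i))) = (of_int K)\<^sup>2 / (of_int N * real (m i))"
    proof -
      have "int (m i) * N * box_sum K (\<lambda>w. of_bool (w - v i \<in> L i)) = K\<^sup>2"
        using box_sum_coset[OF lat[OF i] det_K[OF i] K, of "v i"] unfolding det[OF i] I_E[OF that] .
      then have "real (m i) * of_int N * real_of_int (box_sum K (\<lambda>w. of_bool (w - v i \<in> L i))) = (of_int K)\<^sup>2"
        by (metis of_int_mult of_int_of_nat_eq of_int_power)
      then show ?thesis using N m_pos[OF i] by (simp add: field_simps)
    qed
    ultimately show ?thesis by simp
  qed
  have "(of_int K)\<^sup>2 / of_int N * (\<Sum>i\<in>I. of_int (G (v i)) / real (m i)) = (0::real)"
    using arg_cong[OF sum0, of real_of_int] by (simp add: weighted_count sum_distrib_left)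
  then have "(\<Sum>i\<in>I. of_int (G (v i)) / real (m i)) = 0" using K N by simp
  moreover have "finite I" unfolding I_def by simp
  moreover have "G (v 1) = 1" unfolding G_def c_def using g0 by simp
  ultimately have "(\<Sum>i\<in>I - {1}. real_of_int (- G (v i)) / real (m i)) = 1 / real (p ^ r)"
    using I1 assms(6) by (simp add: sum.remove[of I 1] sum_negf m_def)
  moreover have "0 < m i \<and> m i < p ^ r" if "i \<in> I - {1}" for i
    using I_less[OF that] m_pos[of i] that assms(6) unfolding I_def m_def by auto
  ultimately show False
    using inverse_prime_power_not_sum[OF assms(5), of "I - {1}" m r "\<lambda>i. - G (v i)"] \<open>finite I\<close> by simp
qed

end
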